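(* Let $t\in\mathbb{R}$ with $t>0$ and let $P\ge 1$ be an integer. Define $T:[0,\tfrac{\pi}{2}]\to\mathbb{R}$ by $$T(x)=x-\sum_{k=1}^{P}\frac{(-1)^{k-1}}{2k-1}\left(\frac{\sin(x)-t\cos(x)}{\cos(x)+t\sin(x)}\right)^{2k-1}.$$ Then the following statements hold. (a) $\arctan(t)$ is a fixed point of $T$, i.e. $T(\arctan(t))=\arctan(t)$. (b) The derivatives of $T$ at the fixed point satisfy $T^{(k)}(\arctan(t))=0$ for every integer $k$ with $1\le k\le 2P$, and $T^{(2P+1)}(\arctan(t))=(-1)^{P}(2P)!$. (c) For every initial value $x_0$ sufficiently close to $\arctan(t)$ (that is, there is $\delta>0$ such that for every $x_0\in[0,\tfrac{\pi}{2}]$ with $|x_0-\arctan(t)|\le\delta$), the sequence $x_{n+1}=T(x_n)$, $n=0,1,2,\ldots$, is well defined and converges to $\arctan(t)$ with order of convergence exactly $2P+1$.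
   Context: $T^{(k)}$ denotes the $k$-th derivative of $T$. Note that $\arctan(t)\in(0,\tfrac{\pi}{2})$ and that $\cos(x)+t\sin(x)>0$ on $[0,\tfrac{\pi}{2}]$ for $t>0$, so $T$ is well defined. Order of convergence: a sequence $(x_n)$ converging to $a$, with $x_n\neq a$ for all $n$, converges with order exactly $q$ if the limit $\lim_{n\to\infty}\frac{x_{n+1}-a}{(x_n-a)^{q}}$ exists, is finite and is nonzero (here $q=2P+1$ is a positive integer). The order statement in (c) concerns initial values $x_0\neq\arctan(t)$; for $x_0=\arctan(t)$ the sequence is constant. *)

theory Defs
  imports "HOL-Analysis.Analysis"
begin

text \<open>The formula is given on all of the reals; only its values on \<open>{0..pi/2}\<close>, where the
  denominator is positive for \<open>t > 0\<close>, are meaningful.\<close>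

definition arctan_step :: "real \<Rightarrow> nat \<Rightarrow> real \<Rightarrow> real" where
  "arctan_step t P x =
     x - (\<Sum>k = 1..P. (-1) ^ (k - 1) / real (2 * k - 1)
            * ((sin x - t * cos x) / (cos x + t * sin x)) ^ (2 * k - 1))"

text \<open>Since \<^const>\<open>deriv\<close> is total, existence of the lower-order derivatives near \<open>a\<close> has to be
  required explicitly.\<close>

definition has_nth_derivative :: "(real \<Rightarrow> real) \<Rightarrow> nat \<Rightarrow> real \<Rightarrow> real \<Rightarrow> bool" where
  "has_nth_derivative f n D a \<longleftrightarrow>
     (\<forall>m. Suc m < n \<longrightarrow> (\<forall>\<^sub>F x in nhds a. (deriv ^^ m) f field_differentiable at x)) \<and>
     (case n of 0 \<Rightarrow> f a = D | Suc m \<Rightarrow> ((deriv ^^ m) f has_real_derivative D) (at a))"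

definition converges_with_order :: "(nat \<Rightarrow> real) \<Rightarrow> real \<Rightarrow> nat \<Rightarrow> bool" where
  "converges_with_order x a q \<longleftrightarrow>
     x \<longlonglongrightarrow> a \<and> (\<forall>n. x n \<noteq> a) \<and>
     (\<exists>L. L \<noteq> 0 \<and> (\<lambda>n. (x (Suc n) - a) / (x n - a) ^ q) \<longlonglongrightarrow> L)"

end

theory Submission
  imports Defs "HOL-Computational_Algebra.Polynomial"
begin

text \<open>With \<open>a = arctan t\<close> the quotient in the iteration map \<open>T\<close> is \<open>tan (x - a)\<close>, and summing a
  geometric series gives \<open>T' x = (-1)^P * tan (x - a) ^ (2 * P)\<close>. Each further derivative lowers
  the order of vanishing at \<open>a\<close> by one, and by l'Hopital's rule
  \<open>(T x - a) / (x - a) ^ (2 * P + 1)\<close> tends to \<open>(-1)^P / (2 * P + 1)\<close>.\<close>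

text \<open>Numerator and denominator are \<open>sin (x - arctan t)\<close> and
  \<open>cos (x - arctan t)\<close>, both divided by the nonzero \<open>cos (arctan t)\<close>.
  Where the denominator vanishes so does \<open>cos (x - arctan t)\<close>, and both sides are 0 by
  the convention for division by zero.\<close>

lemma tan_diff_arctan:
  fixes t x :: real
  shows "(sin x - t * cos x) / (cos x + t * sin x) = tan (x - arctan t)"
proof -
  have s: "sin (arctan t) = t * cos (arctan t)"
    using tan_arctan[of t] cos_arctan_not_zero[of t] by (simp add: tan_def field_simps)
  have "sin (x - arctan t) = (sin x - t * cos x) * cos (arctan t)"
    "cos (x - arctan t) = (cos x + t * sin x) * cos (arctan t)"
    by (simp_all add: sin_diff cos_diff s algebra_simps)
  then show ?thesis
    using cos_arctan_not_zero[of t] by (simp add: tan_def)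
qed

lemma arctan_step_eq_tan:
  "arctan_step t P x =
     x - (\<Sum>j<P. (-1) ^ j / real (2 * j + 1) * tan (x - arctan t) ^ (2 * j + 1))"
  unfolding arctan_step_def tan_diff_arctan
  by (simp add: sum.atLeast_Suc_atMost_Suc_shift[symmetric] sum.atLeast1_atMost_eq)

lemma arctan_step_fixpoint: "arctan_step t P (arctan t) = arctan t"
  by (simp add: arctan_step_eq_tan)

lemma cos_diff_nonzero:
  fixes x a :: real
  assumes "x \<in> ball a (pi/2)"
  shows "cos (x - a) \<noteq> 0"
proof -
  have "- (pi/2) < x - a" "x - a < pi/2"
    using assms unfolding mem_ball dist_real_def by linarith+
  then have "cos (x - a) > 0"
    by (rule cos_gt_zero_pi)
  then show ?thesis
    by simp
qed

lemma geometric_sum_mult_neg_square: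
  fixes s :: real
  shows "(\<Sum>j<P. (-1) ^ j * s ^ (2 * j)) * (1 + s\<^sup>2) = 1 - (-1) ^ P * s ^ (2 * P)"
  by (induction P) (simp_all add: algebra_simps power2_eq_square)

text \<open>Written in terms of \<open>tan\<close> itself, so that differentiating a polynomial in
  \<open>tan\<close> gives a polynomial in \<open>tan\<close> again.\<close>

lemma DERIV_tan':
  fixes x :: real
  assumes "cos x \<noteq> 0"
  shows "(tan has_real_derivative 1 + (tan x)\<^sup>2) (at x)"
  using DERIV_tan[OF assms] tan_sec[OF assms] by (simp add: power_inverse)

lemma DERIV_tan_diff:
  fixes x a :: real
  assumes "cos (x - a) \<noteq> 0"
  shows "((\<lambda>x. tan (x - a)) has_real_derivative 1 + (tan (x - a))\<^sup>2) (at x)"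
  by (rule DERIV_cong, rule DERIV_chain2[where f = tan and g = "\<lambda>x. x - a"],
      rule DERIV_tan'[OF assms])
    (auto intro!: derivative_eq_intros)

text \<open>The factor \<open>2 * j + 1\<close> from the chain rule cancels the coefficient of each
  summand. The common inner derivative \<open>1 + ?s\<^sup>2\<close> collapses the geometric sum of
  ratio \<open>- ?s\<^sup>2\<close>, and the leading 1 cancels.\<close>

lemma DERIV_arctan_step:
  assumes "cos (x - arctan t) \<noteq> 0"
  shows "(arctan_step t P has_real_derivative (-1) ^ P * tan (x - arctan t) ^ (2 * P)) (at x)"
proof -
  let ?s = "tan (x - arctan t)"
  have "((\<lambda>x. x - (\<Sum>j<P. (-1) ^ j / real (2 * j + 1) * tan (x - arctan t) ^ (2 * j + 1)))
      has_real_derivative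
      1 - (\<Sum>j<P. (-1) ^ j / real (2 * j + 1) * (real (2 * j + 1) * (1 + ?s\<^sup>2) * ?s ^ (2 * j)))) (at x)"
    by (intro DERIV_diff DERIV_ident DERIV_sum DERIV_cmult
          DERIV_cong[OF DERIV_power[OF DERIV_tan_diff[OF assms]]]) simp
  also have "(\<Sum>j<P. (-1) ^ j / real (2 * j + 1) * (real (2 * j + 1) * (1 + ?s\<^sup>2) * ?s ^ (2 * j)))
      = (\<Sum>j<P. (-1) ^ j * ?s ^ (2 * j)) * (1 + ?s\<^sup>2)"
    unfolding sum_distrib_right by (intro sum.cong refl) (simp add: field_simps)
  finally show ?thesis
    unfolding geometric_sum_mult_neg_square arctan_step_eq_tan[abs_def] by simp
qed

text \<open>Each differentiation removes one factor \<open>tan\<close> and multiplies the value of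
  the cofactor \<open>q\<close> at 0 by the removed exponent, so
  \<open>fact (2 * P - j) * poly q 0\<close> stays constant. Working on a whole ball rather than at
  the centre alone is what lets the induction differentiate again.\<close>

lemma arctan_step_higher_deriv:
  assumes "j \<le> 2 * P"
  shows "\<exists>q :: real poly. fact (2 * P - j) * poly q 0 = (-1) ^ P * fact (2 * P) \<and>
    (\<forall>x\<in>ball (arctan t) (pi/2). ((deriv ^^ j) (arctan_step t P) has_real_derivative
      tan (x - arctan t) ^ (2 * P - j) * poly q (tan (x - arctan t))) (at x))"
  using assms
proof (induction j)
  case 0
  show ?case
    by (rule exI[of _ "[:(-1) ^ P:]"])
      (auto simp: mult.commute intro!: DERIV_cong[OF DERIV_arctan_step] dest: cos_diff_nonzero)
next
  case (Suc j)
  define a where "a = arctan t"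
  define m where "m = 2 * P - Suc j"
  have m: "2 * P - j = Suc m"
    using Suc.prems by (simp add: m_def)
  obtain q :: "real poly" where q0: "fact (Suc m) * poly q 0 = (-1) ^ P * fact (2 * P)"
    and D: "\<And>x. x \<in> ball a (pi/2) \<Longrightarrow> ((deriv ^^ j) (arctan_step t P) has_real_derivative
      tan (x - a) ^ Suc m * poly q (tan (x - a))) (at x)"
    using Suc unfolding a_def m by auto
  \<comment> \<open>With s = tan (x - a) and s' = 1 + s^2, the derivative of s^(m+1) q(s) is s^m
    ((m+1) q(s) + s q'(s)) (1 + s^2). The factor \<open>[:1, 0, 1:]\<close> is 1 + s^2, and r(0) =
    (m+1) q(0).\<close>
  define r where "r = (smult (of_nat (Suc m)) q + [:0, 1:] * pderiv q) * [:1, 0, 1:]"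
  have "((deriv ^^ Suc j) (arctan_step t P) has_real_derivative
      tan (x - a) ^ m * poly r (tan (x - a))) (at x)"
    if x: "x \<in> ball a (pi/2)" for x
  proof (rule has_field_derivative_transform_within_open[OF _ open_ball x])
    show "((\<lambda>x. tan (x - a) ^ Suc m * poly q (tan (x - a))) has_real_derivative
        tan (x - a) ^ m * poly r (tan (x - a))) (at x)"
      by (rule derivative_eq_intros DERIV_tan_diff DERIV_chain2[OF poly_DERIV]
            cos_diff_nonzero[OF x] refl)+
        (simp add: r_def algebra_simps power2_eq_square)
    show "tan (y - a) ^ Suc m * poly q (tan (y - a)) = (deriv ^^ Suc j) (arctan_step t P) y"
      if "y \<in> ball a (pi/2)" for y
      using DERIV_imp_deriv[OF D[OF that]] by simp
  qed
  moreover have "fact m * poly r 0 = (-1) ^ P * fact (2 * P)"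
    using q0 by (simp add: r_def algebra_simps)
  ultimately show ?case
    unfolding a_def m_def by blast
qed

lemma has_nth_derivative_arctan_step:
  assumes "1 \<le> k" "k \<le> 2 * P + 1"
  shows "has_nth_derivative (arctan_step t P) k
    (if k = 2 * P + 1 then (-1) ^ P * fact (2 * P) else 0) (arctan t)"
proof -
  obtain j where k: "k = Suc j" and j: "j \<le> 2 * P"
    using assms by (cases k) auto
  have "\<forall>\<^sub>F x in nhds (arctan t). (deriv ^^ m) (arctan_step t P) field_differentiable at x"
    if "Suc m < k" for m
  proof -
    have "m \<le> 2 * P"
      using that assms by simp
    from arctan_step_higher_deriv[OF this, of t]
    have "(deriv ^^ m) (arctan_step t P) field_differentiable at x"
      if "x \<in> ball (arctan t) (pi/2)" for x
      using that by (meson field_differentiable_def)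
    then show ?thesis
      by (intro eventually_nhds[THEN iffD2] exI[of _ "ball (arctan t) (pi/2)"]) auto
  qed
  moreover from arctan_step_higher_deriv[OF j, of t]
  obtain q :: "real poly" where q0: "fact (2 * P - j) * poly q 0 = (-1) ^ P * fact (2 * P)"
    and "((deriv ^^ j) (arctan_step t P) has_real_derivative 0 ^ (2 * P - j) * poly q 0)
      (at (arctan t))"
    by (metis centre_in_ball pi_half_gt_zero diff_self tan_zero)
  \<comment> \<open>The tangent vanishes at the centre, so the value is 0 unless the exponent
    \<open>2 * P - j\<close> is 0. That happens exactly for \<open>k = 2 * P + 1\<close>, where
    \<open>poly q 0\<close> is the claimed constant.\<close>
  then have "((deriv ^^ j) (arctan_step t P) has_real_derivative
      (if k = 2 * P + 1 then (-1) ^ P * fact (2 * P) else 0)) (at (arctan t))"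
    using j by (elim DERIV_cong) (auto simp: k)
  ultimately show ?thesis
    by (simp add: has_nth_derivative_def k)
qed

lemma arctan_step_leading_term:
  "((\<lambda>x. (arctan_step t P x - arctan t) / (x - arctan t) ^ (2 * P + 1))
     \<longlongrightarrow> (-1) ^ P / real (2 * P + 1)) (at (arctan t))"
proof -
  define a where "a = arctan t"
  have near: "\<forall>\<^sub>F x in at a. x \<in> ball a (pi/2) \<and> x \<noteq> a"
    using eventually_at_ball'[of "pi/2" a UNIV] by simp
  \<comment> \<open>This is the difference quotient of \<open>tan (x - a)\<close> at
    \<open>a\<close>, where the derivative is 1.\<close>
  have "((\<lambda>x. tan (x - a) / (x - a)) \<longlongrightarrow> 1) (at a)"
    using DERIV_tan_diff[of a a] by (simp add: has_field_derivative_iff)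
  from tendsto_mult[OF tendsto_const[of "(-1) ^ P / real (2 * P + 1)"] tendsto_power[OF this, of "2 * P"]]
  have lim: "((\<lambda>x. (-1) ^ P * tan (x - a) ^ (2 * P) / (real (2 * P + 1) * (x - a) ^ (2 * P)))
      \<longlongrightarrow> (-1) ^ P / real (2 * P + 1)) (at a)"
    by (simp add: power_divide)
  have "isCont (arctan_step t P) a"
    by (rule DERIV_isCont, rule DERIV_arctan_step) (simp add: a_def)
  then have "((\<lambda>x. arctan_step t P x - a) \<longlongrightarrow> 0) (at a)"
    using arctan_step_fixpoint[of t P] by (auto simp: isCont_def a_def intro: LIM_zero)
  moreover have "((\<lambda>x. (x - a) ^ (2 * P + 1)) \<longlongrightarrow> 0) (at a)"
    by (auto intro!: tendsto_eq_intros)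
  moreover have "\<forall>\<^sub>F x in at a. (x - a) ^ (2 * P + 1) \<noteq> 0"
    "\<forall>\<^sub>F x in at a. real (2 * P + 1) * (x - a) ^ (2 * P) \<noteq> 0"
    using near by (eventually_elim, simp)+
  moreover have "\<forall>\<^sub>F x in at a. ((\<lambda>x. arctan_step t P x - a) has_real_derivative
      (-1) ^ P * tan (x - a) ^ (2 * P)) (at x)"
    using near
    by eventually_elim
      (rule DERIV_cong, rule DERIV_diff[OF DERIV_arctan_step DERIV_const],
        auto simp: a_def simp del: mem_ball dest: cos_diff_nonzero)
  moreover have "\<forall>\<^sub>F x in at a. ((\<lambda>x. (x - a) ^ (2 * P + 1)) has_real_derivative
      real (2 * P + 1) * (x - a) ^ (2 * P)) (at x)"
    by (intro always_eventually allI
          DERIV_cong[OF DERIV_power[OF DERIV_diff[OF DERIV_ident DERIV_const]]]) simp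
  ultimately show ?thesis
    unfolding a_def[symmetric]
    using lim by (rule lhopital)
qed

text \<open>Since q \<ge> 2, the limit makes (f x - a) / (x - a) tend to 0, so near \<open>a\<close>
  each step at least halves the distance to \<open>a\<close>. As L \<noteq> 0, no step from a nearby
  point other than \<open>a\<close> lands on \<open>a\<close>. The bound on all iterates is recorded
  so that they can later be confined to an interval.\<close>

lemma local_convergence_with_order:
  fixes f :: "real \<Rightarrow> real"
  assumes fixpoint: "f a = a"
    and lim: "((\<lambda>x. (f x - a) / (x - a) ^ q) \<longlongrightarrow> L) (at a)"
    and "L \<noteq> 0" "q \<ge> 2"
  shows "\<exists>\<delta>>0. \<forall>x. \<bar>x - a\<bar> \<le> \<delta> \<longrightarrow>
    (\<forall>n. \<bar>(f ^^ n) x - a\<bar> \<le> \<bar>x - a\<bar>) \<and> (\<lambda>n. (f ^^ n) x) \<longlonglongrightarrow> a \<and>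
    (x \<noteq> a \<longrightarrow> converges_with_order (\<lambda>n. (f ^^ n) x) a q)"
proof -
  have nz: "\<forall>\<^sub>F x in at a. f x \<noteq> a"
    using tendsto_imp_eventually_ne[OF lim \<open>L \<noteq> 0\<close>] by eventually_elim auto
  have "((\<lambda>x. (f x - a) / (x - a) ^ q * (x - a) ^ (q - 1)) \<longlongrightarrow> L * (a - a) ^ (q - 1)) (at a)"
    by (intro tendsto_intros lim)
  \<comment> \<open>At x = a both sides are 0, again by division by zero, so no case distinction on
    x is needed.\<close>
  moreover have "(f x - a) / (x - a) ^ q * (x - a) ^ (q - 1) = (f x - a) / (x - a)" for x
    using \<open>q \<ge> 2\<close> by (cases q) auto
  ultimately have "((\<lambda>x. (f x - a) / (x - a)) \<longlongrightarrow> 0) (at a)"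
    using \<open>q \<ge> 2\<close> by (simp add: zero_power)
  then have "\<forall>\<^sub>F x in at a. \<bar>(f x - a) / (x - a)\<bar> < 1 / 2"
    by (auto dest!: tendstoD[of _ _ _ "1/2"])
  with nz have "\<forall>\<^sub>F x in at a. f x \<noteq> a \<and> \<bar>(f x - a) / (x - a)\<bar> < 1 / 2"
    by (rule eventually_conj)
  then obtain \<delta> where "\<delta> > 0"
    and \<delta>: "\<And>x. x \<noteq> a \<Longrightarrow> \<bar>x - a\<bar> \<le> \<delta> \<Longrightarrow> f x \<noteq> a \<and> \<bar>(f x - a) / (x - a)\<bar> < 1 / 2"
    unfolding eventually_at_le by (auto simp: dist_real_def)
  have half: "\<bar>f x - a\<bar> \<le> \<bar>x - a\<bar> / 2" if "\<bar>x - a\<bar> \<le> \<delta>" for x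
    using \<delta>[of x] that fixpoint by (cases "x = a") (auto simp: abs_divide field_simps)
  have "(\<forall>n. \<bar>(f ^^ n) x - a\<bar> \<le> \<bar>x - a\<bar>) \<and> (\<lambda>n. (f ^^ n) x) \<longlonglongrightarrow> a \<and>
    (x \<noteq> a \<longrightarrow> converges_with_order (\<lambda>n. (f ^^ n) x) a q)" if x: "\<bar>x - a\<bar> \<le> \<delta>" for x
  proof -
    have bound: "\<bar>(f ^^ n) x - a\<bar> \<le> \<bar>x - a\<bar> * (1/2) ^ n" for n
    proof (induction n)
      case (Suc n)
      \<comment> \<open>The geometric bound itself keeps the current iterate within \<delta> of
        \<open>a\<close>, where \<open>half\<close> applies.\<close>
      have "\<bar>x - a\<bar> * (1/2) ^ n \<le> \<bar>x - a\<bar>"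
        by (intro mult_left_le power_le_one) auto
      then have "\<bar>f ((f ^^ n) x) - a\<bar> \<le> \<bar>(f ^^ n) x - a\<bar> / 2"
        using Suc x by (intro half) linarith
      with Suc show ?case
        by simp
    qed simp
    have close: "\<bar>(f ^^ n) x - a\<bar> \<le> \<bar>x - a\<bar>" for n
      by (rule order_trans[OF bound]) (intro mult_left_le power_le_one; simp)
    have "(\<lambda>n. \<bar>x - a\<bar> * (1/2) ^ n) \<longlonglongrightarrow> \<bar>x - a\<bar> * 0"
      by (intro tendsto_intros LIMSEQ_power_zero) simp
    then have "(\<lambda>n. (f ^^ n) x - a) \<longlonglongrightarrow> 0"
      unfolding mult_zero_right
      by (rule Lim_null_comparison[rotated]) (simp only: real_norm_def bound eventually_True)
    then have conv: "(\<lambda>n. (f ^^ n) x) \<longlonglongrightarrow> a"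
      by (rule LIM_zero_cancel)
    have "converges_with_order (\<lambda>n. (f ^^ n) x) a q" if "x \<noteq> a"
    proof -
      have ne: "(f ^^ n) x \<noteq> a" for n
        by (induction n) (use that \<delta> close x in \<open>auto intro: order_trans\<close>)
      \<comment> \<open>Avoiding \<open>a\<close> is what turns convergence into a limit along the
        punctured filter \<open>at a\<close>, so that \<open>lim\<close> can be composed with the
        iteration.\<close>
      with conv have "filterlim (\<lambda>n. (f ^^ n) x) (at a) sequentially"
        by (simp add: filterlim_at)
      from filterlim_compose[OF lim this] show ?thesis
        using conv ne \<open>L \<noteq> 0\<close> by (auto simp: converges_with_order_def)
    qed
    with close conv show ?thesis
      by blast
  qed
  with \<open>\<delta> > 0\<close> show ?thesis
    by blast
qed

theorem mainTheorem1:
  fixes t :: real and P :: nat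
  assumes "t > 0" and "P \<ge> 1"
  shows "(arctan t \<in> {0..pi/2} \<and> arctan_step t P (arctan t) = arctan t)
    \<and> ((\<forall>k. 1 \<le> k \<and> k \<le> 2 * P \<longrightarrow> has_nth_derivative (arctan_step t P) k 0 (arctan t))
       \<and> has_nth_derivative (arctan_step t P) (2 * P + 1) ((-1) ^ P * fact (2 * P)) (arctan t))
    \<and> (\<exists>\<delta>>0. \<forall>x\<^sub>0\<in>{0..pi/2}. \<bar>x\<^sub>0 - arctan t\<bar> \<le> \<delta> \<longrightarrow>
         (\<forall>n. (arctan_step t P ^^ n) x\<^sub>0 \<in> {0..pi/2})
         \<and> (\<lambda>n. (arctan_step t P ^^ n) x\<^sub>0) \<longlonglongrightarrow> arctan t
         \<and> (x\<^sub>0 \<noteq> arctan t \<longrightarrow>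
              converges_with_order (\<lambda>n. (arctan_step t P ^^ n) x\<^sub>0) (arctan t) (2 * P + 1)))"
proof (intro conjI)
  have a: "0 < arctan t" "arctan t < pi/2"
    using \<open>t > 0\<close> arctan_ubound[of t] by auto
  then show "arctan t \<in> {0..pi/2}"
    by simp
  show "arctan_step t P (arctan t) = arctan t"
    by (rule arctan_step_fixpoint)
  show "\<forall>k. 1 \<le> k \<and> k \<le> 2 * P \<longrightarrow> has_nth_derivative (arctan_step t P) k 0 (arctan t)"
  proof (intro allI impI)
    fix k
    assume "1 \<le> k \<and> k \<le> 2 * P"
    then show "has_nth_derivative (arctan_step t P) k 0 (arctan t)"
      using has_nth_derivative_arctan_step[of k P t] by simp
  qed
  show "has_nth_derivative (arctan_step t P) (2 * P + 1) ((-1) ^ P * fact (2 * P)) (arctan t)"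
    using has_nth_derivative_arctan_step[of "2 * P + 1" P t] by simp
  obtain \<delta> where "\<delta> > 0" and \<delta>: "\<And>x. \<bar>x - arctan t\<bar> \<le> \<delta> \<Longrightarrow>
      (\<forall>n. \<bar>(arctan_step t P ^^ n) x - arctan t\<bar> \<le> \<bar>x - arctan t\<bar>)
      \<and> (\<lambda>n. (arctan_step t P ^^ n) x) \<longlonglongrightarrow> arctan t
      \<and> (x \<noteq> arctan t \<longrightarrow>
           converges_with_order (\<lambda>n. (arctan_step t P ^^ n) x) (arctan t) (2 * P + 1))"
    using local_convergence_with_order[OF arctan_step_fixpoint arctan_step_leading_term, of P t]
      \<open>P \<ge> 1\<close> by auto
  \<comment> \<open>The closed \<epsilon>-interval around \<open>arctan t\<close> lies inside
    \<open>{0..pi/2}\<close>, and \<epsilon> is positive because \<open>arctan t\<close> is an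
    interior point. Iterates never move farther from \<open>arctan t\<close> than the initial value,
    so they stay in the domain.\<close>
  define \<epsilon> where "\<epsilon> = min \<delta> (min (arctan t) (pi/2 - arctan t))"
  have "\<epsilon> > 0"
    using \<open>\<delta> > 0\<close> a by (simp add: \<epsilon>_def)
  have inside: "y \<in> {0..pi/2}" if "\<bar>y - arctan t\<bar> \<le> \<epsilon>" for y
    using that unfolding \<epsilon>_def by (simp add: abs_le_iff)
  show "\<exists>\<delta>>0. \<forall>x\<^sub>0\<in>{0..pi/2}. \<bar>x\<^sub>0 - arctan t\<bar> \<le> \<delta> \<longrightarrow>
      (\<forall>n. (arctan_step t P ^^ n) x\<^sub>0 \<in> {0..pi/2})
      \<and> (\<lambda>n. (arctan_step t P ^^ n) x\<^sub>0) \<longlonglongrightarrow> arctan t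
      \<and> (x\<^sub>0 \<noteq> arctan t \<longrightarrow>
           converges_with_order (\<lambda>n. (arctan_step t P ^^ n) x\<^sub>0) (arctan t) (2 * P + 1))"
  proof (intro exI[of _ \<epsilon>] conjI \<open>\<epsilon> > 0\<close> ballI impI allI)
    fix x
    assume x: "\<bar>x - arctan t\<bar> \<le> \<epsilon>"
    then have "\<bar>x - arctan t\<bar> \<le> \<delta>"
      by (simp add: \<epsilon>_def)
    note \<delta>x = \<delta>[OF this]
    show "(arctan_step t P ^^ n) x \<in> {0..pi/2}" for n
      using \<delta>x x by (intro inside) (meson order_trans)
    show "(\<lambda>n. (arctan_step t P ^^ n) x) \<longlonglongrightarrow> arctan t"
      using \<delta>x by blast
    show "converges_with_order (\<lambda>n. (arctan_step t P ^^ n) x) (arctan t) (2 * P + 1)"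
      if "x \<noteq> arctan t"
      using \<delta>x that by blast
  qed
qed

end
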